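(* Let $C>0$ be a constant and let $(\varepsilon_n)_{n\ge 1}$ be a sequence of positive numbers with $\varepsilon_n\to 0$ and $n\varepsilon_n^2\to\infty$. Suppose the prior $\Pi$ satisfies, for every $n$, $$\Pi(\{f\in\mathbb{F}: K(f^\star,f)\le \varepsilon_n^2\})\ \ge\ e^{-Cn\varepsilon_n^2}.$$ Then $$\frac1n\sum_{i=1}^n \mathsf{E}\{K(f^\star,\hat f_{i-1})\}\ \le\ (C+1)\,\varepsilon_n^2 .$$ Furthermore, if $\bar f_n = n^{-1}\sum_{i=1}^n \hat f_{i-1}$, then $$\mathsf{E}\{K(f^\star,\bar f_n)\}\ \le\ (C+1)\,\varepsilon_n^2 .$$
   Context: Let $(\mathbb{Y},\mathscr{Y})$ be a measurable space with a $\sigma$-finite measure $\mu$. Let $Y_1,Y_2,\ldots$ be independent $\mathbb{Y}$-valued random variables with common $\mu$-density $f^\star$ (the true density); $\mathsf{E}$ and $\mathsf{P}$ refer to this iid $f^\star$ model. Let $\mathbb{F}$ be a set of $\mu$-probability densities (with the usual measurable structure making the integrals below meaningful) and $\Pi$ a probability measure (the prior) on $\mathbb{F}$. Let $R_0(f)\equiv 1$ and $R_n(f)=\prod_{i=1}^n f(Y_i)/f^\star(Y_i)$ for $n\ge1$. The posterior distribution given $Y_1,\ldots,Y_n$ is $$\Pi_n(A)=\frac{\int_A R_n(f)\,\Pi(df)}{\int_{\mathbb{F}}R_n(f)\,\Pi(df)},\quad A\subseteq\mathbb{F},$$ with $\Pi_0=\Pi$. The predictive density (posterior mean) is $\hat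 f_n=\int f\,\Pi_n(df)$, $n\ge 0$; in particular $\hat f_0=\int f\,\Pi(df)$. The Kullback--Leibler divergence is $K(f^\star,f)=\int \log(f^\star/f)\,f^\star\,d\mu$. *)

theory Defs
  imports "HOL-Probability.Probability"
begin

(* Densities are ennreal-valued, as in the library constants density and distributed. *)
definition prob_density :: "'y measure \<Rightarrow> ('y \<Rightarrow> ennreal) \<Rightarrow> bool" where
  "prob_density \<mu> f \<longleftrightarrow> f \<in> borel_measurable \<mu> \<and> (\<integral>\<^sup>+ y. f y \<partial>\<mu>) = 1"

(* e2ennreal truncates negative numbers to 0, so the two terms are the integrals of the
   positive and of the negative part. If both are infinite the value is \<infinity>, because
   \<infinity> - \<infinity> = \<infinity> in ereal. *)
definition ext_integral :: "'a measure \<Rightarrow> ('a \<Rightarrow> ereal) \<Rightarrow> ereal" where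
  "ext_integral M g =
     enn2ereal (\<integral>\<^sup>+ x. e2ennreal (g x) \<partial>M) - enn2ereal (\<integral>\<^sup>+ x. e2ennreal (- g x) \<partial>M)"

definition ext_ln :: "ennreal \<Rightarrow> ereal" where
  "ext_ln x = (if x = 0 then -\<infinity> else if x = \<infinity> then \<infinity> else ereal (ln (enn2real x)))"

(* The arithmetic of ennreal and ereal gives the usual conventions: the integrand is 0 where
   p = 0 (0 times \<plusminus>\<infinity> is 0), and \<infinity> where p > 0 = q (then p / q = \<infinity>). *)
definition KL_dens :: "'y measure \<Rightarrow> ('y \<Rightarrow> ennreal) \<Rightarrow> ('y \<Rightarrow> ennreal) \<Rightarrow> ereal" where
  "KL_dens \<mu> p q = ext_integral \<mu> (\<lambda>y. ext_ln (p y / q y) * enn2ereal (p y))"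

(* In the following, y is the data sequence y 1, y 2, ...; the entry y 0 is never used. *)
definition lik_ratio ::
  "('y \<Rightarrow> ennreal) \<Rightarrow> (nat \<Rightarrow> 'y) \<Rightarrow> nat \<Rightarrow> ('y \<Rightarrow> ennreal) \<Rightarrow> ennreal" where
  "lik_ratio fstar y n f = (\<Prod>i = 1..n. f (y i) / fstar (y i))"

definition posterior ::
  "('y \<Rightarrow> ennreal) measure \<Rightarrow> ('y \<Rightarrow> ennreal) \<Rightarrow> (nat \<Rightarrow> 'y) \<Rightarrow> nat \<Rightarrow>
    ('y \<Rightarrow> ennreal) measure" where
  "posterior prior fstar y n =
     density prior (\<lambda>f. lik_ratio fstar y n f / (\<integral>\<^sup>+ g. lik_ratio fstar y n g \<partial>prior))"

definition predictive ::
  "('y \<Rightarrow> ennreal) measure \<Rightarrow> ('y \<Rightarrow> ennreal) \<Rightarrow> (nat \<Rightarrow> 'y) \<Rightarrow> nat \<Rightarrow> 'y \<Rightarrow> ennreal" where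
  "predictive prior fstar y n x = (\<integral>\<^sup>+ f. f x \<partial>(posterior prior fstar y n))"

definition avg_predictive ::
  "('y \<Rightarrow> ennreal) measure \<Rightarrow> ('y \<Rightarrow> ennreal) \<Rightarrow> (nat \<Rightarrow> 'y) \<Rightarrow> nat \<Rightarrow> 'y \<Rightarrow> ennreal" where
  "avg_predictive prior fstar y n x = (\<Sum>i = 1..n. predictive prior fstar y (i - 1) x) / of_nat n"

lemma ext_integral_eq_lebesgue:
  assumes "integrable M g"
  shows "ext_integral M (\<lambda>x. ereal (g x)) = ereal (\<integral>x. g x \<partial>M)"
proof -
  have e: "e2ennreal (ereal r) = ennreal r" for r
    by (simp add: ennreal.abs_eq)
  obtain r q where rq: "0 \<le> r" "0 \<le> q" "(\<integral>\<^sup>+ x. ennreal (g x) \<partial>M) = ennreal r"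
      "(\<integral>\<^sup>+ x. ennreal (- g x) \<partial>M) = ennreal q" "(\<integral>x. g x \<partial>M) = r - q"
    using integrableE[OF assms] by metis
  show ?thesis
    using rq by (simp add: ext_integral_def e)
qed

lemma emeasure_posterior:
  assumes [measurable]: "lik_ratio fstar y n \<in> borel_measurable prior" and A: "A \<in> sets prior"
  shows "emeasure (posterior prior fstar y n) A =
    (\<integral>\<^sup>+ f \<in> A. lik_ratio fstar y n f \<partial>prior) / (\<integral>\<^sup>+ f. lik_ratio fstar y n f \<partial>prior)"
proof -
  have "emeasure (posterior prior fstar y n) A =
      (\<integral>\<^sup>+ f. (lik_ratio fstar y n f * indicator A f) / (\<integral>\<^sup>+ g. lik_ratio fstar y n g \<partial>prior) \<partial>prior)"
    unfolding posterior_def using A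
    by (subst emeasure_density) (auto simp: divide_ennreal_def ac_simps)
  also have "\<dots> = (\<integral>\<^sup>+ f \<in> A. lik_ratio fstar y n f \<partial>prior) / (\<integral>\<^sup>+ f. lik_ratio fstar y n f \<partial>prior)"
    using A by (intro nn_integral_divide) simp
  finally show ?thesis .
qed

lemma posterior_0: "prob_space prior \<Longrightarrow> posterior prior fstar y 0 = prior"
  by (simp add: posterior_def lik_ratio_def prob_space.emeasure_space_1 density_1)

end

theory Submission
  imports Defs
begin

text \<open>
  Let \<open>D\<^sub>n = \<integral> R\<^sub>n d\<Pi>\<close>. Since \<open>D\<^sub>n / D\<^sub>n\<^sub>-\<^sub>1\<close> is the ratio of the predictive density to the true density at
  \<open>Y\<^sub>n\<close>, the chain rule gives \<open>E(- ln D\<^sub>n) = \<Sum>i. E K(f*, f\<^sub>i\<^sub>-\<^sub>1)\<close>. Conversely, restricting the prior to a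
  Kullback--Leibler ball \<open>A\<close> and using \<open>- ln u \<ge> 1 - u\<close> at \<open>u = \<Pi>(A) R\<^sub>n(f) / D\<^sub>n\<close> yields
  \<open>E(- ln D\<^sub>n) \<le> n \<epsilon>\<^sup>2 - ln \<Pi>(A)\<close>. The averaged predictive density is handled by convexity.

  To stay within nonnegative integrals, \<open>- ln t\<close> is replaced throughout by \<open>t - ln t \<ge> 1\<close>: the added
  integrals of \<open>t\<close> are all at most 1 and cancel.
\<close>

section \<open>The function t - ln t on the extended nonnegative reals\<close>

text \<open>The values at \<open>0\<close> and \<open>\<top>\<close> are the limits of t - ln t
  there; the real expression alone would be finite at both points.\<close>

definition sub_ln :: "ennreal \<Rightarrow> ennreal" where
  "sub_ln t = (if t = 0 \<or> t = \<top> then \<top> else ennreal (enn2real t - ln (enn2real t)))"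

lemma sub_ln_0 [simp]: "sub_ln 0 = \<top>" and sub_ln_top [simp]: "sub_ln \<top> = \<top>"
  by (simp_all add: sub_ln_def)

lemma sub_ln_1 [simp]: "sub_ln 1 = 1"
  by (simp add: sub_ln_def)

lemma sub_ln_ennreal: "0 < t \<Longrightarrow> sub_ln (ennreal t) = ennreal (t - ln t)"
  by (simp add: sub_ln_def)

lemma measurable_sub_ln [measurable]: "sub_ln \<in> borel_measurable borel"
  unfolding sub_ln_def by measurable

lemma ennreal_cases_0_top:
  obtains "t = 0" | "t = \<top>" | r where "0 < r" "t = ennreal r"
  by (cases t) (metis ennreal_0 less_eq_real_def, auto)

lemma sub_ln_ge_1: "1 \<le> sub_ln t"
proof (cases t rule: ennreal_cases_0_top)
  case (3 r)
  then have "1 \<le> r - ln r" using ln_le_minus_one[of r] by simp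
  then show ?thesis using 3 by (metis ennreal_1 ennreal_leI sub_ln_ennreal)
qed auto

text \<open>This is ln (a b) = ln a + ln b with the negative terms moved across: both sides equal a
  + b + a b - ln a - ln b. If a factor is \<open>0\<close> or \<open>\<top>\<close>, both sides are
  \<open>\<top>\<close>, so the law holds on all of \<open>ennreal\<close>.\<close>

lemma sub_ln_mult: "sub_ln a + sub_ln b + a * b = a + b + sub_ln (a * b)"
proof (cases a rule: ennreal_cases_0_top)
  case 2
  then show ?thesis by (cases "b = 0") (auto simp: ennreal_top_mult)
next
  case a: (3 r)
  show ?thesis
  proof (cases b rule: ennreal_cases_0_top)
    case 2
    then show ?thesis using a by (auto simp: ennreal_mult_top)
  next
    case b: (3 q)
    have "0 \<le> r - ln r" "0 \<le> q - ln q" "0 \<le> r * q - ln (r * q)"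
      using a b ln_le_minus_one[of r] ln_le_minus_one[of q] ln_le_minus_one[of "r * q"] by auto
    then show ?thesis using a b
      by (simp add: sub_ln_ennreal ln_mult flip: ennreal_mult ennreal_plus)
  qed auto
qed auto

text \<open>The inequality 1 - u \<le> - ln u at u = p r / d, after adding d + r and rearranging.
  The bound \<open>p \<le> 1\<close> keeps - ln p nonnegative, so \<open>ennreal\<close> does not
  truncate it. For \<open>r\<close> equal to \<open>0\<close> or \<open>\<top>\<close> the term
  \<open>sub_ln r\<close> is infinite.\<close>

lemma sub_ln_variational:
  assumes d: "0 < d" "d \<noteq> \<top>" and p: "0 < p" "p \<le> 1"
  shows "sub_ln d + r + 1 \<le> d + sub_ln r + ennreal (- ln p) + ennreal p * r / d"
proof (cases r rule: ennreal_cases_0_top)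
  case r: (3 x)
  obtain y where y: "0 < y" "d = ennreal y"
    using d by (cases d rule: ennreal_cases_0_top) auto
  have ln: "ln (p * x / y) = ln p + ln x - ln y"
    using p r y by (simp add: ln_mult ln_div)
  have "ln (p * x / y) \<le> p * x / y - 1"
    using p r y by (intro ln_le_minus_one) simp
  then have "(y - ln y) + x + 1 \<le> y + (x - ln x) + (- ln p) + p * x / y"
    using ln by simp
  moreover have "0 \<le> y - ln y" "0 \<le> x - ln x" "0 \<le> - ln p" "0 \<le> p * x / y"
    using r y p ln_le_minus_one[of y] ln_le_minus_one[of x] by auto
  moreover from this have "0 \<le> y + (x - ln x) - ln p"
    using y by linarith
  ultimately have "ennreal ((y - ln y) + x + 1) \<le> ennreal (y + (x - ln x) + (- ln p) + p * x / y)"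
    by (intro ennreal_leI)
  then show ?thesis
    using r y p \<open>0 \<le> y - ln y\<close> \<open>0 \<le> x - ln x\<close> \<open>0 \<le> - ln p\<close> \<open>0 \<le> p * x / y\<close>
      \<open>0 \<le> y + (x - ln x) - ln p\<close>
    by (simp add: sub_ln_ennreal divide_ennreal flip: ennreal_mult ennreal_plus ennreal_1)
qed auto

text \<open>Jensen for the concave \<open>ln\<close> with equal weights; the linear part of t - ln t
  averages exactly. A single \<open>t i\<close> equal to \<open>0\<close> or \<open>\<top>\<close>
  makes the right side infinite.\<close>

lemma sub_ln_mean:
  assumes "finite I" "I \<noteq> {}"
  shows "sub_ln ((\<Sum>i\<in>I. t i) / of_nat (card I)) \<le> (\<Sum>i\<in>I. sub_ln (t i)) / of_nat (card I)"
proof (cases "\<forall>i\<in>I. t i \<noteq> 0 \<and> t i \<noteq> \<top>")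
  case False
  then obtain i where "i \<in> I" "sub_ln (t i) = \<top>" by auto
  then have "(\<Sum>i\<in>I. sub_ln (t i)) = \<top>"
    using \<open>finite I\<close> by auto
  then show ?thesis by (simp add: ennreal_top_divide)
next
  case True
  define u where "u i = enn2real (t i)" for i
  have u: "0 < u i" "t i = ennreal (u i)" if "i \<in> I" for i
    using True that by (auto simp: u_def enn2real_positive_iff top.not_eq_extremum zero_less_iff_neq_zero)
  let ?n = "real (card I)"
  have n: "0 < ?n" using assms by (simp add: card_gt_0_iff)
  have S: "0 < (\<Sum>i\<in>I. u i)" using assms u by (intro sum_pos) auto
  have "(\<Sum>i\<in>I. (1 / ?n) * ln (u i)) \<le> ln (\<Sum>i\<in>I. (1 / ?n) * u i)"
    using concave_on_sum[of I "{0<..}" ln "\<lambda>_. 1 / ?n" u] assms ln_concave u n by simp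
  then have le: "(\<Sum>i\<in>I. u i) / ?n - ln ((\<Sum>i\<in>I. u i) / ?n) \<le> (\<Sum>i\<in>I. u i - ln (u i)) / ?n"
    by (simp add: sum_subtractf diff_divide_distrib flip: sum_divide_distrib)
  have nn: "0 \<le> u i - ln (u i)" if "i \<in> I" for i
    using u[OF that] ln_le_minus_one[of "u i"] by simp
  have "(\<Sum>i\<in>I. t i) = ennreal (\<Sum>i\<in>I. u i)" "(\<Sum>i\<in>I. sub_ln (t i)) = ennreal (\<Sum>i\<in>I. u i - ln (u i))"
    using u nn by (auto simp: sub_ln_ennreal less_imp_le simp flip: sum_ennreal intro!: sum.cong)
  then show ?thesis
    using n S le nn by (simp add: divide_ennreal sub_ln_ennreal sum_nonneg ennreal_of_nat_eq_real_of_nat ennreal_leI)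
qed

text \<open>Equality holds for \<open>a\<close> strictly between \<open>0\<close> and
  \<open>\<top>\<close>; at these two values the left side is \<open>0\<close>. For densities this
  discards the mass of \<open>q\<close> on the set where \<open>p\<close> vanishes.\<close>

lemma ennreal_mult_divide_le: "(a :: ennreal) * (b / a) \<le> b"
  by (cases "a = 0 \<or> a = \<top>") (auto simp: ennreal_times_divide mult_divide_eq_ennreal mult.commute[of a])

section \<open>Kullback-Leibler divergence as a difference of nonnegative integrals\<close>

text \<open>With t = q / p, the integral of - p ln t is that of p (t - ln t) minus that of p t. The
  latter is not replaced by 1, since \<open>q\<close> may have mass where \<open>p\<close> is 0 or
  total mass below 1.\<close>

definition KL_nn :: "'y measure \<Rightarrow> ('y \<Rightarrow> ennreal) \<Rightarrow> ('y \<Rightarrow> ennreal) \<Rightarrow> ennreal" where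
  "KL_nn \<mu> p q = (\<integral>\<^sup>+ y. p y * sub_ln (q y / p y) \<partial>\<mu>) - (\<integral>\<^sup>+ y. p y * (q y / p y) \<partial>\<mu>)"

lemma nn_integral_ratio_le: "(\<integral>\<^sup>+ y. p y * (q y / p y) \<partial>\<mu>) \<le> (\<integral>\<^sup>+ y. q y \<partial>\<mu>)"
  by (intro nn_integral_mono ennreal_mult_divide_le)

text \<open>The truncated subtraction in \<open>KL_nn\<close> is exact: the subtracted integral is
  at most 1, the total mass of \<open>p\<close>, and t - ln t \<ge> 1 puts the other integral above
  it. Later arguments work with this additive form.\<close>

lemma KL_nn_add:
  assumes p: "prob_density \<mu> p" and q: "(\<integral>\<^sup>+ y. q y \<partial>\<mu>) \<le> 1"
  shows "KL_nn \<mu> p q + (\<integral>\<^sup>+ y. p y * (q y / p y) \<partial>\<mu>) = (\<integral>\<^sup>+ y. p y * sub_ln (q y / p y) \<partial>\<mu>)"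
proof -
  have "(\<integral>\<^sup>+ y. p y * (q y / p y) \<partial>\<mu>) \<le> (\<integral>\<^sup>+ y. p y * 1 \<partial>\<mu>)"
    using p order_trans[OF nn_integral_ratio_le q] by (simp add: prob_density_def)
  also have "\<dots> \<le> (\<integral>\<^sup>+ y. p y * sub_ln (q y / p y) \<partial>\<mu>)"
    by (intro nn_integral_mono mult_left_mono sub_ln_ge_1) simp
  finally show ?thesis
    unfolding KL_nn_def by (intro diff_add_cancel_ennreal)
qed

lemma measurable_ext_ln [measurable]: "ext_ln \<in> borel_measurable borel"
  unfolding ext_ln_def by measurable

text \<open>The splitting of \<open>l\<close> into positive and negative part, shifted by
  \<open>b\<close> so that no subtraction remains. It is used pointwise with \<open>l\<close> the
  integrand p ln (p / q) and \<open>b\<close> the value of q.\<close>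

lemma e2ennreal_balance:
  assumes "- l \<le> b" "0 < b"
  shows "e2ennreal (ereal l) + ennreal b = ennreal (b + l) + e2ennreal (- ereal l)
    \<and> e2ennreal (- ereal l) \<le> ennreal b"
proof -
  have "e2ennreal (ereal r) = ennreal r" for r
    by (simp add: ennreal.abs_eq)
  then have eq: "e2ennreal (ereal l) = ennreal l" "e2ennreal (- ereal l) = ennreal (- l)"
    by auto
  show ?thesis
  proof (cases "0 \<le> l")
    case True
    then show ?thesis
      using assms unfolding eq by (simp add: ennreal_neg add.commute)
  next
    case False
    then show ?thesis
      using assms ennreal_plus[of "b + l" "- l"] unfolding eq by (simp add: ennreal_neg ennreal_leI)
  qed
qed

lemma ennreal_cancel_common:
  fixes a s g n k :: ennreal
  assumes "a + s = g + n" "k + s = g" "s \<noteq> \<top>"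
  shows "a = k + n"
proof -
  have "s + a = s + (k + n)" using assms(1,2) by (auto simp: ac_simps)
  then show ?thesis using assms(3) by (simp add: ennreal_add_left_cancel)
qed

lemma ennreal_add_right_le_cancel: "a + s \<le> b + s \<Longrightarrow> s < \<top> \<Longrightarrow> a \<le> (b :: ennreal)"
  using ennreal_add_left_cancel_le[of s a b] by (auto simp: add.commute)

text \<open>Almost everywhere, the positive part of p ln (p / q) plus p (q / p) equals p times
  \<open>sub_ln (q / p)\<close> plus the negative part, which is at most p (q / p). After
  integration the finite terms cancel; in particular the extended integral never meets \<infinity> -
  \<infinity>.\<close>

lemma KL_dens_eq:
  assumes p: "prob_density \<mu> p" and q: "q \<in> borel_measurable \<mu>" "(\<integral>\<^sup>+ y. q y \<partial>\<mu>) \<le> 1"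
  shows "KL_dens \<mu> p q = enn2ereal (KL_nn \<mu> p q)"
proof -
  have [measurable]: "p \<in> borel_measurable \<mu>" "q \<in> borel_measurable \<mu>"
    using p q by (auto simp: prob_density_def)
  let ?h = "\<lambda>y. ext_ln (p y / q y) * enn2ereal (p y)"
  let ?pos = "\<integral>\<^sup>+ y. e2ennreal (?h y) \<partial>\<mu>" and ?neg = "\<integral>\<^sup>+ y. e2ennreal (- ?h y) \<partial>\<mu>"
  let ?s = "\<integral>\<^sup>+ y. p y * (q y / p y) \<partial>\<mu>" and ?G = "\<integral>\<^sup>+ y. p y * sub_ln (q y / p y) \<partial>\<mu>"
  have finp: "AE y in \<mu>. p y \<noteq> \<infinity>"
    using p by (intro nn_integral_noteq_infinite) (auto simp: prob_density_def)
  have finq: "AE y in \<mu>. q y \<noteq> \<infinity>"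
    using q by (intro nn_integral_noteq_infinite) (auto simp: top_unique)
  have pw: "e2ennreal (?h y) + p y * (q y / p y) = p y * sub_ln (q y / p y) + e2ennreal (- ?h y)
      \<and> e2ennreal (- ?h y) \<le> p y * (q y / p y)" if "p y \<noteq> \<infinity>" "q y \<noteq> \<infinity>" for y
  proof (cases "p y" rule: ennreal_cases_0_top)
    case 1
    then show ?thesis by (simp add: zero_ennreal.rep_eq flip: zero_ennreal_def)
  next
    case 2
    then show ?thesis using that by simp
  next
    case a: (3 a)
    show ?thesis
    proof (cases "q y" rule: ennreal_cases_0_top)
      \<comment> \<open>Here p > 0 = q: both sides are infinite and the negative part is 0.\<close>
      case 1
      then show ?thesis using a
        by (simp add: ext_ln_def ennreal_divide_eq_top_iff e2ennreal_neg)
    next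
      case 2
      then show ?thesis using that by simp
    next
      case b: (3 b)
      have h: "?h y = ereal (ln (a / b) * a)"
        using a b by (simp add: ext_ln_def divide_ennreal)
      \<comment> \<open>Multiplied by \<open>a\<close>, this bounds the negative part of the
        integrand: a ln (b / a) \<le> b.\<close>
      have "ln (b / a) \<le> b / a - 1" using a b by (intro ln_le_minus_one) simp
      then have 1: "0 \<le> b / a - ln (b / a)" by linarith
      then have "ln (b / a) * a \<le> (b / a) * a"
        using a by (intro mult_right_mono) auto
      moreover have "ln (a / b) = - ln (b / a)" using a b by (simp add: ln_div)
      ultimately have 2: "- (ln (a / b) * a) \<le> b" using a by simp
      have 3: "p y * (q y / p y) = ennreal b"
        using a b by (simp add: divide_ennreal flip: ennreal_mult)
      have "0 < b / a" "ennreal a * ennreal (b / a - ln (b / a)) = ennreal (a * (b / a - ln (b / a)))"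
        using a b 1 by (auto simp del: ennreal_mult simp flip: ennreal_mult)
      moreover have "a * (b / a - ln (b / a)) = b + ln (a / b) * a"
        using a b by (simp add: ln_div algebra_simps)
      ultimately have 4: "p y * sub_ln (q y / p y) = ennreal (b + ln (a / b) * a)"
        using a b by (simp add: divide_ennreal sub_ln_ennreal)
      show ?thesis
        unfolding h 3 4 by (rule e2ennreal_balance[OF 2 b(1)])
    qed
  qed
  have "?pos + ?s = (\<integral>\<^sup>+ y. e2ennreal (?h y) + p y * (q y / p y) \<partial>\<mu>)"
    by (intro nn_integral_add[symmetric]) measurable
  also have "\<dots> = (\<integral>\<^sup>+ y. p y * sub_ln (q y / p y) + e2ennreal (- ?h y) \<partial>\<mu>)"
  proof (intro nn_integral_cong_AE)
    show "AE y in \<mu>. e2ennreal (?h y) + p y * (q y / p y) = p y * sub_ln (q y / p y) + e2ennreal (- ?h y)"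
      using finp finq by eventually_elim (rule conjunct1[OF pw])
  qed
  also have "\<dots> = ?G + ?neg"
    by (intro nn_integral_add) measurable
  finally have eq: "?pos + ?s = ?G + ?neg" .
  have "?neg \<le> ?s"
  proof (intro nn_integral_mono_AE)
    show "AE y in \<mu>. e2ennreal (- ?h y) \<le> p y * (q y / p y)"
      using finp finq by eventually_elim (rule conjunct2[OF pw])
  qed
  moreover have "?s \<le> 1"
    using order_trans[OF nn_integral_ratio_le q(2)] .
  ultimately have fin: "?neg \<noteq> \<top>" "?s \<noteq> \<top>"
    by (auto simp: top_unique)
  have "?pos = KL_nn \<mu> p q + ?neg"
    by (rule ennreal_cancel_common[OF eq KL_nn_add[OF p q(2)] fin(2)])
  moreover have "\<bar>enn2ereal ?neg\<bar> \<noteq> \<infinity>"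
    using fin(1) by (cases ?neg) auto
  ultimately show ?thesis
    unfolding KL_dens_def ext_integral_def
    by (simp add: plus_ennreal.rep_eq ereal_add_diff_cancel)
qed

lemma ext_integral_enn2ereal:
  assumes "\<And>x. x \<in> space M \<Longrightarrow> g x = enn2ereal (f x)"
  shows "ext_integral M g = enn2ereal (\<integral>\<^sup>+ x. f x \<partial>M)"
proof -
  have "e2ennreal (- enn2ereal t) = 0" for t
    by (intro e2ennreal_neg) simp
  with assms have "(\<integral>\<^sup>+ x. e2ennreal (- g x) \<partial>M) = (\<integral>\<^sup>+ x. 0 \<partial>M)"
    by (intro nn_integral_cong) auto
  moreover have "(\<integral>\<^sup>+ x. e2ennreal (g x) \<partial>M) = (\<integral>\<^sup>+ x. f x \<partial>M)"
    using assms by (intro nn_integral_cong) auto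
  ultimately show ?thesis by (simp add: ext_integral_def zero_ennreal.rep_eq)
qed

text \<open>Convexity of the divergence in its second argument: \<open>sub_ln_mean\<close> is
  applied to the ratios q i / p, while the integral of p (q / p), being linear in q, is the same
  finite number on both sides and cancels. The mass bound comes first because
  \<open>KL_nn_add\<close> requires it of the mixture.\<close>

lemma KL_nn_mean:
  assumes p: "prob_density \<mu> p" and I: "finite I" "I \<noteq> {}"
    and q: "\<And>i. i \<in> I \<Longrightarrow> q i \<in> borel_measurable \<mu>" "\<And>i. i \<in> I \<Longrightarrow> (\<integral>\<^sup>+ y. q i y \<partial>\<mu>) \<le> 1"
  shows "(\<integral>\<^sup>+ y. (\<Sum>i\<in>I. q i y) / of_nat (card I) \<partial>\<mu>) \<le> 1"
    and "KL_nn \<mu> p (\<lambda>y. (\<Sum>i\<in>I. q i y) / of_nat (card I)) \<le> (\<Sum>i\<in>I. KL_nn \<mu> p (q i)) / of_nat (card I)"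
proof -
  have [measurable]: "p \<in> borel_measurable \<mu>" using p by (simp add: prob_density_def)
  note q(1)[measurable]
  let ?n = "of_nat (card I) :: ennreal"
  let ?m = "\<lambda>y. (\<Sum>i\<in>I. q i y) / ?n"
  have n: "?n \<noteq> 0" "?n \<noteq> \<top>" using I by auto
  have "(\<integral>\<^sup>+ y. ?m y \<partial>\<mu>) = (\<Sum>i\<in>I. \<integral>\<^sup>+ y. q i y \<partial>\<mu>) / ?n"
    by (simp add: nn_integral_divide nn_integral_sum)
  also have "\<dots> \<le> (\<Sum>i\<in>I. 1) / ?n"
    using q by (intro divide_right_mono_ennreal sum_mono) auto
  also have "\<dots> = 1" using n ennreal_divide_self[of ?n]
    by (metis mult.right_neutral sum_constant top.not_eq_extremum)
  finally show m: "(\<integral>\<^sup>+ y. ?m y \<partial>\<mu>) \<le> 1" .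
  have s: "(\<integral>\<^sup>+ y. p y * (?m y / p y) \<partial>\<mu>) = (\<Sum>i\<in>I. \<integral>\<^sup>+ y. p y * (q i y / p y) \<partial>\<mu>) / ?n"
  proof -
    have "p y * (?m y / p y) = (\<Sum>i\<in>I. p y * (q i y / p y)) / ?n" for y
      by (simp add: divide_ennreal_def sum_distrib_right sum_distrib_left mult_ac)
    then have "(\<integral>\<^sup>+ y. p y * (?m y / p y) \<partial>\<mu>) = (\<integral>\<^sup>+ y. (\<Sum>i\<in>I. p y * (q i y / p y)) / ?n \<partial>\<mu>)"
      by (intro nn_integral_cong) auto
    also have "\<dots> = (\<Sum>i\<in>I. \<integral>\<^sup>+ y. p y * (q i y / p y) \<partial>\<mu>) / ?n"
      by (simp add: nn_integral_divide nn_integral_sum)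
    finally show ?thesis .
  qed
  have "(\<integral>\<^sup>+ y. p y * sub_ln (?m y / p y) \<partial>\<mu>) \<le> (\<integral>\<^sup>+ y. (\<Sum>i\<in>I. p y * sub_ln (q i y / p y)) / ?n \<partial>\<mu>)"
  proof (intro nn_integral_mono)
    fix y
    have "?m y / p y = (\<Sum>i\<in>I. q i y / p y) / ?n"
      by (simp add: divide_ennreal_def sum_distrib_right sum_distrib_left mult_ac)
    then have "p y * sub_ln (?m y / p y) \<le> p y * ((\<Sum>i\<in>I. sub_ln (q i y / p y)) / ?n)"
      using sub_ln_mean[OF I] by (auto intro: mult_left_mono)
    then show "p y * sub_ln (?m y / p y) \<le> (\<Sum>i\<in>I. p y * sub_ln (q i y / p y)) / ?n"
      by (simp add: sum_distrib_left ennreal_times_divide)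
  qed
  also have "\<dots> = (\<Sum>i\<in>I. \<integral>\<^sup>+ y. p y * sub_ln (q i y / p y) \<partial>\<mu>) / ?n"
    by (simp add: nn_integral_divide nn_integral_sum)
  also have "\<dots> = (\<Sum>i\<in>I. KL_nn \<mu> p (q i) + (\<integral>\<^sup>+ y. p y * (q i y / p y) \<partial>\<mu>)) / ?n"
    using KL_nn_add[OF p q(2)] by simp
  also have "\<dots> = (\<Sum>i\<in>I. KL_nn \<mu> p (q i)) / ?n + (\<integral>\<^sup>+ y. p y * (?m y / p y) \<partial>\<mu>)"
    unfolding s by (simp add: sum.distrib add_divide_distrib_ennreal)
  finally have "KL_nn \<mu> p ?m + (\<integral>\<^sup>+ y. p y * (?m y / p y) \<partial>\<mu>)
      \<le> (\<Sum>i\<in>I. KL_nn \<mu> p (q i)) / ?n + (\<integral>\<^sup>+ y. p y * (?m y / p y) \<partial>\<mu>)"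
    using KL_nn_add[OF p m] by simp
  moreover have "(\<integral>\<^sup>+ y. p y * (?m y / p y) \<partial>\<mu>) < \<top>"
    using order_trans[OF nn_integral_ratio_le m] by (rule le_less_trans) simp
  ultimately show "KL_nn \<mu> p ?m \<le> (\<Sum>i\<in>I. KL_nn \<mu> p (q i)) / ?n"
    by (rule ennreal_add_right_le_cancel)
qed

section \<open>Variational bound for the logarithm of an integral\<close>

text \<open>\<open>sub_ln_variational\<close>, with d the integral of \<open>r\<close> and p the
  mass of \<open>A\<close>, is integrated over \<open>A\<close>. Its last term contributes at most
  p, because the integral of \<open>r\<close> over \<open>A\<close> is at most d, and this cancels
  the p coming from the constant 1.\<close>

lemma (in prob_space) sub_ln_nn_integral_bound:
  assumes r[measurable]: "r \<in> borel_measurable M" and A[measurable]: "A \<in> sets M" and pos: "0 < prob A"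
  shows "ennreal (prob A) * sub_ln (\<integral>\<^sup>+ x. r x \<partial>M) + (\<integral>\<^sup>+ x \<in> A. r x \<partial>M)
    \<le> ennreal (prob A) * (\<integral>\<^sup>+ x. r x \<partial>M) + (\<integral>\<^sup>+ x \<in> A. sub_ln (r x) \<partial>M)
      + ennreal (prob A) * ennreal (- ln (prob A))"
proof -
  define d where "d = (\<integral>\<^sup>+ x. r x \<partial>M)"
  define p where "p = prob A"
  have p: "0 < p" "p \<le> 1" using pos by (auto simp: p_def)
  have em: "emeasure M A = ennreal p" by (simp add: p_def emeasure_eq_measure)
  show ?thesis unfolding d_def[symmetric] p_def[symmetric]
  proof (cases "d = 0 \<or> d = \<top>")
    \<comment> \<open>If d = 0, then \<open>r\<close> vanishes almost everywhere and the integral of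
      \<open>sub_ln (r x)\<close> is infinite, as \<open>A\<close> has positive mass; if
      \<open>d = \<top>\<close>, then p d is infinite.\<close>
    case True
    then show "ennreal p * sub_ln d + (\<integral>\<^sup>+ x \<in> A. r x \<partial>M)
      \<le> ennreal p * d + (\<integral>\<^sup>+ x \<in> A. sub_ln (r x) \<partial>M) + ennreal p * ennreal (- ln p)"
    proof
      assume "d = 0"
      then have "AE x in M. r x = 0"
        unfolding d_def by (simp add: nn_integral_0_iff_AE)
      then have "(\<integral>\<^sup>+ x \<in> A. sub_ln (r x) \<partial>M) = (\<integral>\<^sup>+ x. \<top> * indicator A x \<partial>M)"
        by (intro nn_integral_cong_AE) (auto elim!: eventually_mono)
      also have "\<dots> = \<top>"
        using p em by (subst nn_integral_cmult_indicator) (auto simp: ennreal_top_mult)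
      finally show ?thesis by simp
    next
      assume "d = \<top>"
      then show ?thesis using p by (simp add: ennreal_mult_top)
    qed
  next
    case False
    then have d: "0 < d" "d \<noteq> \<top>" by (auto simp: zero_less_iff_neq_zero)
    let ?L = "ennreal (- ln p)"
    let ?R = "\<integral>\<^sup>+ x \<in> A. r x \<partial>M" and ?S = "\<integral>\<^sup>+ x \<in> A. sub_ln (r x) \<partial>M"
    have "?R \<le> d" unfolding d_def by (intro nn_integral_mono) (auto simp: indicator_def)
    then have "?R / d \<le> d / d" by (rule divide_right_mono_ennreal)
    also have "d / d = 1" using d by (simp add: ennreal_divide_self top.not_eq_extremum)
    finally have Rd: "ennreal p * (?R / d) \<le> ennreal p * 1" by (intro mult_left_mono) auto
    have "(ennreal p * sub_ln d + ?R) + ennreal p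
        = (\<integral>\<^sup>+ x. sub_ln d * indicator A x + r x * indicator A x + 1 * indicator A x \<partial>M)"
      by (simp add: nn_integral_add nn_integral_cmult_indicator em mult.commute)
    also have "\<dots> = (\<integral>\<^sup>+ x \<in> A. sub_ln d + r x + 1 \<partial>M)"
      by (simp add: distrib_right)
    also have "\<dots> \<le> (\<integral>\<^sup>+ x \<in> A. d + sub_ln (r x) + ?L + ennreal p * r x / d \<partial>M)"
      by (intro nn_integral_mono mult_right_mono sub_ln_variational d p) simp
    also have "\<dots> = (\<integral>\<^sup>+ x. d * indicator A x + sub_ln (r x) * indicator A x + ?L * indicator A x
        + ennreal p * (r x * indicator A x / d) \<partial>M)"
      by (intro nn_integral_cong) (simp add: divide_ennreal_def mult_ac split: split_indicator)
    also have "\<dots> = ennreal p * d + ?S + ennreal p * ?L + ennreal p * (?R / d)"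
      by (simp add: nn_integral_add nn_integral_cmult_indicator nn_integral_cmult nn_integral_divide em)
        (simp add: mult.commute)
    also have "\<dots> \<le> ennreal p * d + ?S + ennreal p * ?L + ennreal p"
      using Rd by (intro add_left_mono) simp
    finally show "ennreal p * sub_ln d + ?R \<le> ennreal p * d + ?S + ennreal p * ?L"
      by (rule ennreal_add_right_le_cancel) simp
  qed
qed

section \<open>Likelihood ratios and predictive densities as functions of the data\<close>

lemma lik_ratio_0 [simp]: "lik_ratio fstar y 0 f = 1"
  by (simp add: lik_ratio_def)

lemma lik_ratio_Suc:
  "lik_ratio fstar y (Suc n) f = lik_ratio fstar y n f * (f (y (Suc n)) / fstar (y (Suc n)))"
  by (simp add: lik_ratio_def)

text \<open>Only the entries 1 to n are read, so the likelihood factors through the finite product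
  space on which independence is expressed.\<close>

lemma lik_ratio_restrict: "lik_ratio fstar (restrict y {1..n}) n = lik_ratio fstar y n"
  by (auto simp: lik_ratio_def fun_eq_iff)

lemma predictive_restrict:
  "predictive prior fstar (restrict y {1..n}) n = predictive prior fstar y n"
  by (rule ext) (simp only: predictive_def posterior_def lik_ratio_restrict)

section \<open>The iid model: joint measurability and one-step updating\<close>

locale iid_bayes = P: prob_space P + prior: prob_space prior + mu: sigma_finite_measure \<mu>
  for P :: "'w measure" and prior :: "('y \<Rightarrow> ennreal) measure" and \<mu> :: "'y measure" +
  fixes Y :: "nat \<Rightarrow> 'w \<Rightarrow> 'y" and fstar :: "'y \<Rightarrow> ennreal"
  assumes fstar: "prob_density \<mu> fstar"
    and indep: "P.indep_vars (\<lambda>_. \<mu>) Y {1..}"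
    and distr: "\<And>i. i \<ge> 1 \<Longrightarrow> distributed P \<mu> (Y i) fstar"
    and dens: "\<And>f. f \<in> space prior \<Longrightarrow> prob_density \<mu> f"
    and eval_meas: "(\<lambda>(f, y). f y) \<in> borel_measurable (prior \<Otimes>\<^sub>M \<mu>)"
begin

lemma measurable_fstar [measurable]: "fstar \<in> borel_measurable \<mu>"
  using fstar by (simp add: prob_density_def)

lemma measurable_dens: "f \<in> space prior \<Longrightarrow> f \<in> borel_measurable \<mu>"
  using dens by (simp add: prob_density_def)

lemma measurable_Y: "1 \<le> i \<Longrightarrow> Y i \<in> measurable P \<mu>"
  using distr distributed_measurable by blast

lemma measurable_eval:
  assumes "g \<in> measurable N prior" "h \<in> measurable N \<mu>"
  shows "(\<lambda>x. g x (h x)) \<in> borel_measurable N"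
  using measurable_compose[OF measurable_Pair[OF assms] eval_meas] by simp

text \<open>Data and density both vary with a point of an arbitrary \<open>N\<close>, so one lemma
  covers fixed data, random data and coordinates of a finite product.\<close>

lemma measurable_lik_ratio:
  assumes "\<And>i. i \<in> {1..n} \<Longrightarrow> (\<lambda>x. h x i) \<in> measurable N \<mu>" "g \<in> measurable N prior"
  shows "(\<lambda>x. lik_ratio fstar (h x) n (g x)) \<in> borel_measurable N"
  unfolding lik_ratio_def
  by (intro borel_measurable_prod_ennreal borel_measurable_divide_ennreal measurable_eval assms
      measurable_compose[OF assms(1) measurable_fstar])

lemma measurable_marginal:
  assumes h: "\<And>i. i \<in> {1..n} \<Longrightarrow> (\<lambda>x. h x i) \<in> measurable N \<mu>"
  shows "(\<lambda>x. \<integral>\<^sup>+ f. lik_ratio fstar (h x) n f \<partial>prior) \<in> borel_measurable N"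
proof -
  have "(\<lambda>z. lik_ratio fstar (h (fst z)) n (snd z)) \<in> borel_measurable (N \<Otimes>\<^sub>M prior)"
    by (intro measurable_lik_ratio measurable_compose[OF measurable_fst h] measurable_snd)
  then show ?thesis
    by (intro prior.borel_measurable_nn_integral) (simp add: split_beta')
qed

lemma predictive_eq:
  assumes y: "\<And>i. i \<in> {1..n} \<Longrightarrow> y i \<in> space \<mu>" and x: "x \<in> space \<mu>"
  shows "predictive prior fstar y n x =
    (\<integral>\<^sup>+ f. lik_ratio fstar y n f / (\<integral>\<^sup>+ g. lik_ratio fstar y n g \<partial>prior) * f x \<partial>prior)"
proof -
  have "(\<lambda>f. lik_ratio fstar y n f) \<in> borel_measurable prior" "(\<lambda>f. f x) \<in> borel_measurable prior"
    using y x by (auto intro!: measurable_lik_ratio[where g = "\<lambda>f. f"] measurable_eval[where g = "\<lambda>f. f"])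
  then show ?thesis
    unfolding predictive_def posterior_def by (intro nn_integral_density) auto
qed

lemma measurable_predictive:
  assumes h: "\<And>i. i \<in> {1..n} \<Longrightarrow> (\<lambda>x. h x i) \<in> measurable N \<mu>" and z: "z \<in> measurable N \<mu>"
  shows "(\<lambda>x. predictive prior fstar (h x) n (z x)) \<in> borel_measurable N"
proof -
  have "(\<lambda>x. \<integral>\<^sup>+ f. lik_ratio fstar (h x) n f / (\<integral>\<^sup>+ g. lik_ratio fstar (h x) n g \<partial>prior) * f (z x) \<partial>prior)
      \<in> borel_measurable N"
  proof (rule prior.borel_measurable_nn_integral)
    have "(\<lambda>w. lik_ratio fstar (h (fst w)) n (snd w) / (\<integral>\<^sup>+ g. lik_ratio fstar (h (fst w)) n g \<partial>prior)
        * snd w (z (fst w))) \<in> borel_measurable (N \<Otimes>\<^sub>M prior)"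
      by (intro borel_measurable_times_ennreal borel_measurable_divide_ennreal measurable_lik_ratio
          measurable_marginal measurable_eval measurable_compose[OF measurable_fst h]
          measurable_compose[OF measurable_fst z] measurable_snd)
    then show "(\<lambda>(x, f). lik_ratio fstar (h x) n f / (\<integral>\<^sup>+ g. lik_ratio fstar (h x) n g \<partial>prior)
        * f (z x)) \<in> borel_measurable (N \<Otimes>\<^sub>M prior)"
      by (simp add: split_beta')
  qed
  moreover have "predictive prior fstar (h x) n (z x) =
      (\<integral>\<^sup>+ f. lik_ratio fstar (h x) n f / (\<integral>\<^sup>+ g. lik_ratio fstar (h x) n g \<partial>prior) * f (z x) \<partial>prior)"
    if "x \<in> space N" for x
    using that measurable_space[OF h] measurable_space[OF z] by (intro predictive_eq) auto
  ultimately show ?thesis by (simp cong: measurable_cong)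
qed

text \<open>By Fubini and the unit mass of each density, the integral is the total posterior mass d
  / d. This is 1, except that it is 0 when d is \<open>0\<close> or \<open>\<top>\<close>; hence
  only an inequality.\<close>

lemma nn_integral_predictive_le:
  assumes y: "\<And>i. i \<in> {1..n} \<Longrightarrow> y i \<in> space \<mu>"
  shows "(\<integral>\<^sup>+ x. predictive prior fstar y n x \<partial>\<mu>) \<le> 1"
proof -
  interpret pair_sigma_finite prior \<mu> ..
  let ?d = "\<integral>\<^sup>+ g. lik_ratio fstar y n g \<partial>prior"
  let ?w = "\<lambda>f. lik_ratio fstar y n f / ?d"
  have lik: "(\<lambda>f. lik_ratio fstar y n f) \<in> borel_measurable prior"
    using y by (intro measurable_lik_ratio) auto
  have [measurable]: "?w \<in> borel_measurable prior"
    by (intro borel_measurable_divide_ennreal lik) simp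
  have [measurable]: "(\<lambda>z. fst z (snd z)) \<in> borel_measurable (prior \<Otimes>\<^sub>M \<mu>)"
    by (intro measurable_eval measurable_fst measurable_snd)
  have "(\<integral>\<^sup>+ x. predictive prior fstar y n x \<partial>\<mu>) = (\<integral>\<^sup>+ x. \<integral>\<^sup>+ f. ?w f * f x \<partial>prior \<partial>\<mu>)"
    by (intro nn_integral_cong predictive_eq y) auto
  also have "\<dots> = (\<integral>\<^sup>+ f. \<integral>\<^sup>+ x. ?w f * f x \<partial>\<mu> \<partial>prior)"
    by (rule Fubini') (simp add: split_beta')
  also have "\<dots> = (\<integral>\<^sup>+ f. ?w f \<partial>prior)"
    using dens by (intro nn_integral_cong) (simp add: nn_integral_cmult prob_density_def)
  also have "\<dots> = ?d / ?d"
    by (rule nn_integral_divide[OF lik])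
  also have "\<dots> \<le> 1"
    by (cases "?d = 0 \<or> ?d = \<top>") (auto simp: ennreal_divide_self top.not_eq_extremum)
  finally show ?thesis .
qed

text \<open>The posterior mean of f / fstar at the next observation is the factor by which the
  marginal likelihood changes. The infinite case is excluded because division by
  \<open>\<top>\<close> gives \<open>0\<close> in \<open>ennreal\<close>, so the posterior would
  vanish.\<close>

lemma marginal_Suc:
  assumes y: "\<And>i. i \<in> {1..Suc n} \<Longrightarrow> y i \<in> space \<mu>"
    and fin: "(\<integral>\<^sup>+ f. lik_ratio fstar y n f \<partial>prior) \<noteq> \<top>"
  shows "(\<integral>\<^sup>+ f. lik_ratio fstar y (Suc n) f \<partial>prior) =
    (\<integral>\<^sup>+ f. lik_ratio fstar y n f \<partial>prior) *
      (predictive prior fstar y n (y (Suc n)) / fstar (y (Suc n)))"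
proof -
  let ?d = "\<integral>\<^sup>+ g. lik_ratio fstar y n g \<partial>prior" and ?x = "y (Suc n)"
  have lik: "(\<lambda>f. lik_ratio fstar y n f) \<in> borel_measurable prior"
    using y by (intro measurable_lik_ratio) auto
  have ev: "(\<lambda>f. f ?x) \<in> borel_measurable prior"
    using y by (intro measurable_eval) auto
  \<comment> \<open>Multiplying and dividing by \<open>?d\<close> brings out the posterior weight.
    For \<open>?d = 0\<close> this may fail pointwise, but the likelihood is then 0 almost
    everywhere.\<close>
  have "AE f in prior. lik_ratio fstar y (Suc n) f = ?d * (lik_ratio fstar y n f / ?d * f ?x / fstar ?x)"
  proof (cases "?d = 0")
    case True
    then have "AE f in prior. lik_ratio fstar y n f = 0"
      using lik by (simp add: nn_integral_0_iff_AE)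
    then show ?thesis
      by (auto simp: True lik_ratio_Suc elim!: eventually_mono)
  next
    case False
    then have "?d * (a / ?d) = a" for a
      using fin by (simp add: ennreal_times_divide mult.commute[of ?d] mult_divide_eq_ennreal)
    moreover have "?d * (a / ?d * b / c) = ?d * (a / ?d) * (b / c)" for a b c
      by (simp add: divide_ennreal_def mult_ac)
    ultimately have "?d * (a / ?d * b / c) = a * (b / c)" for a b c
      by simp
    then show ?thesis by (simp add: lik_ratio_Suc)
  qed
  then have "(\<integral>\<^sup>+ f. lik_ratio fstar y (Suc n) f \<partial>prior)
      = (\<integral>\<^sup>+ f. ?d * (lik_ratio fstar y n f / ?d * f ?x / fstar ?x) \<partial>prior)"
    by (rule nn_integral_cong_AE)
  also have "\<dots> = ?d * ((\<integral>\<^sup>+ f. lik_ratio fstar y n f / ?d * f ?x \<partial>prior) / fstar ?x)"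
    using lik ev by (simp add: nn_integral_cmult nn_integral_divide)
  also have "(\<integral>\<^sup>+ f. lik_ratio fstar y n f / ?d * f ?x \<partial>prior) = predictive prior fstar y n ?x"
    using y by (intro predictive_eq[symmetric]) auto
  finally show ?thesis .
qed

section \<open>Integrating out the next observation\<close>

lemma nn_integral_Y:
  "1 \<le> i \<Longrightarrow> h \<in> borel_measurable \<mu> \<Longrightarrow> (\<integral>\<^sup>+ \<omega>. h (Y i \<omega>) \<partial>P) = (\<integral>\<^sup>+ x. fstar x * h x \<partial>\<mu>)"
  using distributed_nn_integral[OF distr] by simp

text \<open>Independence makes the joint law of the first n observations and the next one a product,
  so Fubini integrates the latter against \<open>fstar\<close> with the past held fixed. By
  \<open>restr\<close>, \<open>H\<close> sees only the first n entries and thus lives on the finite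
  product.\<close>

lemma nn_integral_next:
  assumes H: "(\<lambda>(y, x). H y x) \<in> borel_measurable ((\<Pi>\<^sub>M i\<in>{1..n}. \<mu>) \<Otimes>\<^sub>M \<mu>)"
    and restr: "\<And>y. H (restrict y {1..n}) = H y"
  shows "(\<integral>\<^sup>+ \<omega>. H (\<lambda>j. Y j \<omega>) (Y (Suc n) \<omega>) \<partial>P)
    = (\<integral>\<^sup>+ \<omega>. \<integral>\<^sup>+ x. fstar x * H (\<lambda>j. Y j \<omega>) x \<partial>\<mu> \<partial>P)"
proof -
  let ?N = "\<Pi>\<^sub>M i\<in>{1..n}. \<mu>" and ?X = "\<lambda>\<omega>. \<lambda>i\<in>{1..n}. Y i \<omega>"
  \<comment> \<open>The next observation is packed as a product over a singleton, the form in which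
    independence of disjoint blocks is obtained; \<open>z (Suc n)\<close> unpacks it.\<close>
  let ?N' = "\<Pi>\<^sub>M i\<in>{Suc n}. \<mu>" and ?X' = "\<lambda>\<omega>. \<lambda>i\<in>{Suc n}. Y i \<omega>"
  have ind: "P.indep_var ?N ?X ?N' ?X'"
    by (rule P.indep_var_restrict[OF indep]) auto
  have [measurable]: "?X \<in> measurable P ?N" "?X' \<in> measurable P ?N'"
    using P.indep_var_rv1[OF ind] P.indep_var_rv2[OF ind] .
  have "(\<lambda>z. (fst z, snd z (Suc n))) \<in> measurable (?N \<Otimes>\<^sub>M ?N') (?N \<Otimes>\<^sub>M \<mu>)"
    by (intro measurable_Pair measurable_fst measurable_compose[OF measurable_snd]
        measurable_component_singleton) simp
  from measurable_compose[OF this H]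
  have H'[measurable]: "(\<lambda>z. H (fst z) (snd z (Suc n))) \<in> borel_measurable (?N \<Otimes>\<^sub>M ?N')"
    by simp
  note H[measurable]
  interpret S: prob_space "distr P ?N' ?X'" by (rule P.prob_space_distr) measurable
  have "(\<integral>\<^sup>+ \<omega>. H (\<lambda>j. Y j \<omega>) (Y (Suc n) \<omega>) \<partial>P) = (\<integral>\<^sup>+ \<omega>. H (?X \<omega>) (?X' \<omega> (Suc n)) \<partial>P)"
    by (simp only: restr restrict_apply singletonI if_True)
  also have "\<dots> = (\<integral>\<^sup>+ z. H (fst z) (snd z (Suc n)) \<partial>(distr P (?N \<Otimes>\<^sub>M ?N') (\<lambda>\<omega>. (?X \<omega>, ?X' \<omega>))))"
    by (subst nn_integral_distr) measurable
  also have "\<dots> = (\<integral>\<^sup>+ z. H (fst z) (snd z (Suc n)) \<partial>(distr P ?N ?X \<Otimes>\<^sub>M distr P ?N' ?X'))"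
    using ind by (simp only: P.indep_var_distribution_eq)
  also have "\<dots> = (\<integral>\<^sup>+ y. \<integral>\<^sup>+ z. H y (z (Suc n)) \<partial>distr P ?N' ?X' \<partial>distr P ?N ?X)"
  proof (subst S.nn_integral_fst[symmetric])
    have "sets (distr P ?N ?X \<Otimes>\<^sub>M distr P ?N' ?X') = sets (?N \<Otimes>\<^sub>M ?N')"
      by (intro sets_pair_measure_cong) auto
    then show "(\<lambda>z. H (fst z) (snd z (Suc n))) \<in> borel_measurable (distr P ?N ?X \<Otimes>\<^sub>M distr P ?N' ?X')"
      using H' measurable_cong_sets by blast
  qed simp
  also have "\<dots> = (\<integral>\<^sup>+ y. \<integral>\<^sup>+ \<omega>. H y (Y (Suc n) \<omega>) \<partial>P \<partial>distr P ?N ?X)"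
    by (intro nn_integral_cong) (subst nn_integral_distr, auto)
  also have "\<dots> = (\<integral>\<^sup>+ y. \<integral>\<^sup>+ x. fstar x * H y x \<partial>\<mu> \<partial>distr P ?N ?X)"
    by (intro nn_integral_cong nn_integral_Y) auto
  also have "\<dots> = (\<integral>\<^sup>+ \<omega>. \<integral>\<^sup>+ x. fstar x * H (?X \<omega>) x \<partial>\<mu> \<partial>P)"
    by (intro nn_integral_distr) measurable
  also have "\<dots> = (\<integral>\<^sup>+ \<omega>. \<integral>\<^sup>+ x. fstar x * H (\<lambda>j. Y j \<omega>) x \<partial>\<mu> \<partial>P)"
    by (simp only: restr)
  finally show ?thesis .
qed

lemma Y_space: "\<omega> \<in> space P \<Longrightarrow> 1 \<le> i \<Longrightarrow> Y i \<omega> \<in> space \<mu>"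
  using measurable_Y measurable_space by metis

section \<open>Expectations of likelihood ratios and of the marginal likelihood\<close>

abbreviation "R n \<omega> f \<equiv> lik_ratio fstar (\<lambda>j. Y j \<omega>) n f"
abbreviation "D n \<omega> \<equiv> \<integral>\<^sup>+ f. R n \<omega> f \<partial>prior"
abbreviation "Q n \<omega> \<equiv> predictive prior fstar (\<lambda>j. Y j \<omega>) n"

lemma measurable_R [measurable]: "f \<in> space prior \<Longrightarrow> (\<lambda>\<omega>. R n \<omega> f) \<in> borel_measurable P"
  by (intro measurable_lik_ratio measurable_Y) auto

lemma measurable_R_pair: "(\<lambda>(\<omega>, f). R n \<omega> f) \<in> borel_measurable (P \<Otimes>\<^sub>M prior)"
  unfolding split_beta'
  by (intro measurable_lik_ratio measurable_snd measurable_compose[OF measurable_fst] measurable_Y) auto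

lemma measurable_R_prior: "\<omega> \<in> space P \<Longrightarrow> R n \<omega> \<in> borel_measurable prior"
  using measurable_compose[OF measurable_Pair1' measurable_R_pair] by simp

lemma measurable_D [measurable]: "D n \<in> borel_measurable P"
  by (intro measurable_marginal measurable_Y) auto

lemma measurable_Q: "z \<in> measurable N \<mu> \<Longrightarrow> g \<in> measurable N P \<Longrightarrow> (\<lambda>x. Q n (g x) (z x)) \<in> borel_measurable N"
  by (intro measurable_predictive measurable_compose[OF _ measurable_Y]) auto

lemma measurable_Q_dens: "\<omega> \<in> space P \<Longrightarrow> Q n \<omega> \<in> borel_measurable \<mu>"
  by (rule measurable_Q) auto

lemma nn_integral_Q_le: "\<omega> \<in> space P \<Longrightarrow> (\<integral>\<^sup>+ x. Q n \<omega> x \<partial>\<mu>) \<le> 1"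
  by (intro nn_integral_predictive_le Y_space) auto

lemma measurable_Q_pair [measurable]: "(\<lambda>(\<omega>, x). Q n \<omega> x) \<in> borel_measurable (P \<Otimes>\<^sub>M \<mu>)"
  unfolding split_beta' by (rule measurable_Q) auto

lemma measurable_KL_Q [measurable]: "(\<lambda>\<omega>. KL_nn \<mu> fstar (Q n \<omega>)) \<in> borel_measurable P"
  unfolding KL_nn_def by measurable

text \<open>Given the past, the next factor has mean equal to the mass of \<open>f\<close> where
  \<open>fstar\<close> is positive, which is at most 1: a nonnegative supermartingale started at
  1.\<close>

lemma nn_integral_R_le:
  assumes f: "f \<in> space prior"
  shows "(\<integral>\<^sup>+ \<omega>. R n \<omega> f \<partial>P) \<le> 1"
proof (induction n)
  case 0
  show ?case by (simp add: P.emeasure_space_1)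
next
  case (Suc n)
  have [measurable]: "f \<in> borel_measurable \<mu>" by (rule measurable_dens[OF f])
  have f1: "(\<integral>\<^sup>+ x. f x \<partial>\<mu>) = 1" using dens[OF f] by (simp add: prob_density_def)
  have "(\<integral>\<^sup>+ \<omega>. R (Suc n) \<omega> f \<partial>P)
      = (\<integral>\<^sup>+ \<omega>. \<integral>\<^sup>+ x. fstar x * (R n \<omega> f * (f x / fstar x)) \<partial>\<mu> \<partial>P)"
    unfolding lik_ratio_Suc
  proof (rule nn_integral_next)
    show "(\<lambda>(y, x). lik_ratio fstar y n f * (f x / fstar x)) \<in> borel_measurable (Pi\<^sub>M {1..n} (\<lambda>i. \<mu>) \<Otimes>\<^sub>M \<mu>)"
      unfolding split_beta' using f
      by (intro borel_measurable_times_ennreal borel_measurable_divide_ennreal measurable_lik_ratio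
          measurable_compose[OF measurable_fst] measurable_component_singleton measurable_const) measurable
  qed (simp only: lik_ratio_restrict)
  also have "\<dots> \<le> (\<integral>\<^sup>+ \<omega>. R n \<omega> f \<partial>P)"
  proof (intro nn_integral_mono)
    fix \<omega>
    have "(\<integral>\<^sup>+ x. fstar x * (R n \<omega> f * (f x / fstar x)) \<partial>\<mu>) = R n \<omega> f * (\<integral>\<^sup>+ x. fstar x * (f x / fstar x) \<partial>\<mu>)"
      by (subst nn_integral_cmult[symmetric]) (auto simp: mult_ac)
    also have "\<dots> \<le> R n \<omega> f * 1"
      unfolding f1[symmetric] by (intro mult_left_mono nn_integral_ratio_le) simp
    finally show "(\<integral>\<^sup>+ x. fstar x * (R n \<omega> f * (f x / fstar x)) \<partial>\<mu>) \<le> R n \<omega> f" by simp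
  qed
  finally show ?case using Suc by simp
qed

lemma nn_integral_D_le: "(\<integral>\<^sup>+ \<omega>. D n \<omega> \<partial>P) \<le> 1"
proof -
  interpret pair_sigma_finite P prior ..
  have "(\<integral>\<^sup>+ \<omega>. D n \<omega> \<partial>P) = (\<integral>\<^sup>+ f. \<integral>\<^sup>+ \<omega>. R n \<omega> f \<partial>P \<partial>prior)"
    by (rule Fubini'[OF measurable_R_pair, symmetric])
  also have "\<dots> \<le> (\<integral>\<^sup>+ f. 1 \<partial>prior)"
    by (intro nn_integral_mono nn_integral_R_le)
  finally show ?thesis by (simp add: prior.emeasure_space_1)
qed

lemma AE_D_finite: "AE \<omega> in P. D n \<omega> \<noteq> \<top>"
proof -
  have "(\<integral>\<^sup>+ \<omega>. D n \<omega> \<partial>P) \<noteq> \<infinity>"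
    using neq_top_trans[OF _ nn_integral_D_le] by simp
  from nn_integral_noteq_infinite[OF measurable_D this] show ?thesis by simp
qed

section \<open>Chain rules for the expected log likelihood and log marginal likelihood\<close>

text \<open>The logarithm of \<open>R n\<close> is a sum of n identically distributed terms, each
  contributing one divergence; the last summand is the linear part of t - ln t. The induction step
  is \<open>sub_ln_mult\<close> integrated over \<open>P\<close>.\<close>

lemma nn_integral_sub_ln_R:
  assumes f: "f \<in> space prior"
  shows "(\<integral>\<^sup>+ \<omega>. sub_ln (R n \<omega> f) \<partial>P) = of_nat n * KL_nn \<mu> fstar f + (\<integral>\<^sup>+ \<omega>. R n \<omega> f \<partial>P)"
proof (induction n)
  case 0
  show ?case by (simp add: P.emeasure_space_1)
next
  case (Suc n)
  have [measurable]: "f \<in> borel_measurable \<mu>" by (rule measurable_dens[OF f])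
  have [measurable]: "Y (Suc n) \<in> measurable P \<mu>" by (rule measurable_Y) simp
  note measurable_R[OF f, measurable]
  have f1: "(\<integral>\<^sup>+ x. f x \<partial>\<mu>) \<le> 1" using dens[OF f] by (simp add: prob_density_def)
  let ?t = "\<lambda>\<omega>. f (Y (Suc n) \<omega>) / fstar (Y (Suc n) \<omega>)"
  define k where "k = KL_nn \<mu> fstar f"
  define s where "s = (\<integral>\<^sup>+ \<omega>. ?t \<omega> \<partial>P)"
  define a where "a = (\<integral>\<^sup>+ \<omega>. R n \<omega> f \<partial>P)"
  define b where "b = (\<integral>\<^sup>+ \<omega>. R (Suc n) \<omega> f \<partial>P)"
  have s: "s = (\<integral>\<^sup>+ x. fstar x * (f x / fstar x) \<partial>\<mu>)"
    unfolding s_def by (rule nn_integral_Y) auto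
  have g: "(\<integral>\<^sup>+ \<omega>. sub_ln (?t \<omega>) \<partial>P) = k + s"
    unfolding s k_def KL_nn_add[OF fstar f1] by (rule nn_integral_Y) auto
  have "s \<le> 1" unfolding s by (rule order_trans[OF nn_integral_ratio_le f1])
  moreover have "a \<le> 1" unfolding a_def by (rule nn_integral_R_le[OF f])
  ultimately have "s + a \<noteq> \<top>" by (auto simp: top_unique)
  have "(\<integral>\<^sup>+ \<omega>. sub_ln (R n \<omega> f) + sub_ln (?t \<omega>) + R n \<omega> f * ?t \<omega> \<partial>P)
      = (\<integral>\<^sup>+ \<omega>. R n \<omega> f + ?t \<omega> + sub_ln (R n \<omega> f * ?t \<omega>) \<partial>P)"
    by (simp only: sub_ln_mult)
  \<comment> \<open>\<open>a\<close> and \<open>s\<close> are the linear terms of the two factors,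
    each at most 1, and get cancelled; \<open>b\<close> is that of the product and stays in the
    claim.\<close>
  then have "(\<integral>\<^sup>+ \<omega>. sub_ln (R n \<omega> f) \<partial>P) + (k + s) + b = a + s + (\<integral>\<^sup>+ \<omega>. sub_ln (R (Suc n) \<omega> f) \<partial>P)"
    unfolding lik_ratio_Suc a_def b_def s_def g[unfolded s_def, symmetric] by (simp add: nn_integral_add)
  then have "(s + a) + (\<integral>\<^sup>+ \<omega>. sub_ln (R (Suc n) \<omega> f) \<partial>P) = (s + a) + (of_nat (Suc n) * k + b)"
    unfolding Suc a_def[symmetric] k_def[symmetric] by (auto simp: algebra_simps)
  then show ?case
    using \<open>s + a \<noteq> \<top>\<close> by (auto simp: ennreal_add_left_cancel b_def k_def)
qed

text \<open>By \<open>marginal_Suc\<close> the logarithm of \<open>D n\<close> telescopes into log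
  ratios of predictive to true density. Given the past, the next observation is a fresh draw from
  \<open>fstar\<close>, so each ratio contributes one expected divergence. The cumulative risk is
  identified exactly.\<close>

lemma nn_integral_sub_ln_D:
  "(\<Sum>i=1..n. \<integral>\<^sup>+ \<omega>. KL_nn \<mu> fstar (Q (i - 1) \<omega>) \<partial>P) + (\<integral>\<^sup>+ \<omega>. D n \<omega> \<partial>P)
    = (\<integral>\<^sup>+ \<omega>. sub_ln (D n \<omega>) \<partial>P)"
proof (induction n)
  case 0
  show ?case by (simp add: prior.emeasure_space_1 P.emeasure_space_1)
next
  case (Suc n)
  have [measurable]: "Y (Suc n) \<in> measurable P \<mu>" by (rule measurable_Y) simp
  have [measurable]: "(\<lambda>\<omega>. Q n \<omega> (Y (Suc n) \<omega>)) \<in> borel_measurable P"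
    by (rule measurable_Q) auto
  let ?t = "\<lambda>\<omega>. Q n \<omega> (Y (Suc n) \<omega>) / fstar (Y (Suc n) \<omega>)"
  define k where "k = (\<integral>\<^sup>+ \<omega>. KL_nn \<mu> fstar (Q n \<omega>) \<partial>P)"
  define S where "S = (\<Sum>i=1..n. \<integral>\<^sup>+ \<omega>. KL_nn \<mu> fstar (Q (i - 1) \<omega>) \<partial>P)"
  define s where "s = (\<integral>\<^sup>+ \<omega>. ?t \<omega> \<partial>P)"
  define a where "a = (\<integral>\<^sup>+ \<omega>. D n \<omega> \<partial>P)"
  define b where "b = (\<integral>\<^sup>+ \<omega>. D (Suc n) \<omega> \<partial>P)"
  have meas: "(\<lambda>(y, x). predictive prior fstar y n x) \<in> borel_measurable (Pi\<^sub>M {1..n} (\<lambda>i. \<mu>) \<Otimes>\<^sub>M \<mu>)"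
    unfolding split_beta'
    by (intro measurable_predictive measurable_compose[OF measurable_fst] measurable_component_singleton) auto
  have s: "s = (\<integral>\<^sup>+ \<omega>. \<integral>\<^sup>+ x. fstar x * (Q n \<omega> x / fstar x) \<partial>\<mu> \<partial>P)"
    unfolding s_def
  proof (rule nn_integral_next)
    show "(\<lambda>(y, x). predictive prior fstar y n x / fstar x) \<in> borel_measurable (Pi\<^sub>M {1..n} (\<lambda>i. \<mu>) \<Otimes>\<^sub>M \<mu>)"
      using meas unfolding split_beta' by measurable
  qed (simp only: predictive_restrict)
  have "(\<integral>\<^sup>+ \<omega>. sub_ln (?t \<omega>) \<partial>P) = (\<integral>\<^sup>+ \<omega>. \<integral>\<^sup>+ x. fstar x * sub_ln (Q n \<omega> x / fstar x) \<partial>\<mu> \<partial>P)"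
  proof (rule nn_integral_next)
    show "(\<lambda>(y, x). sub_ln (predictive prior fstar y n x / fstar x)) \<in> borel_measurable (Pi\<^sub>M {1..n} (\<lambda>i. \<mu>) \<Otimes>\<^sub>M \<mu>)"
      using meas unfolding split_beta' by measurable
  qed (simp only: predictive_restrict)
  also have "\<dots> = (\<integral>\<^sup>+ \<omega>. KL_nn \<mu> fstar (Q n \<omega>) + (\<integral>\<^sup>+ x. fstar x * (Q n \<omega> x / fstar x) \<partial>\<mu>) \<partial>P)"
    by (intro nn_integral_cong KL_nn_add[symmetric] fstar nn_integral_Q_le)
  also have "\<dots> = k + s"
    unfolding s k_def by (intro nn_integral_add) measurable
  finally have g: "(\<integral>\<^sup>+ \<omega>. sub_ln (?t \<omega>) \<partial>P) = k + s" .
  have "s \<le> (\<integral>\<^sup>+ \<omega>. 1 \<partial>P)"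
    unfolding s by (intro nn_integral_mono order_trans[OF nn_integral_ratio_le] nn_integral_Q_le)
  moreover have "a \<le> 1" unfolding a_def by (rule nn_integral_D_le)
  ultimately have "s + a \<noteq> \<top>" by (auto simp: top_unique P.emeasure_space_1)
  \<comment> \<open>Only almost surely, because the update rule requires \<open>D n\<close>
    finite.\<close>
  have D_Suc: "AE \<omega> in P. D (Suc n) \<omega> = D n \<omega> * ?t \<omega>"
    using AE_D_finite[of n] AE_space by eventually_elim (intro marginal_Suc Y_space, auto)
  have "(\<integral>\<^sup>+ \<omega>. sub_ln (D n \<omega>) + sub_ln (?t \<omega>) + D n \<omega> * ?t \<omega> \<partial>P)
      = (\<integral>\<^sup>+ \<omega>. D n \<omega> + ?t \<omega> + sub_ln (D n \<omega> * ?t \<omega>) \<partial>P)"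
    by (simp only: sub_ln_mult)
  moreover have "b = (\<integral>\<^sup>+ \<omega>. D n \<omega> * ?t \<omega> \<partial>P)"
    unfolding b_def by (rule nn_integral_cong_AE[OF D_Suc])
  moreover have sub: "(\<integral>\<^sup>+ \<omega>. sub_ln (D (Suc n) \<omega>) \<partial>P) = (\<integral>\<^sup>+ \<omega>. sub_ln (D n \<omega> * ?t \<omega>) \<partial>P)"
    by (rule nn_integral_cong_AE) (use D_Suc in eventually_elim, simp)
  ultimately have "(\<integral>\<^sup>+ \<omega>. sub_ln (D n \<omega>) \<partial>P) + (k + s) + b = a + s + (\<integral>\<^sup>+ \<omega>. sub_ln (D (Suc n) \<omega>) \<partial>P)"
    unfolding a_def s_def g[unfolded s_def, symmetric] by (simp add: nn_integral_add)
  then have "(s + a) + (\<integral>\<^sup>+ \<omega>. sub_ln (D (Suc n) \<omega>) \<partial>P) = (s + a) + (S + k + b)"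
    unfolding Suc[symmetric] a_def[symmetric] S_def[symmetric] by (auto simp: ac_simps)
  then show ?case
    using \<open>s + a \<noteq> \<top>\<close> by (auto simp: ennreal_add_left_cancel b_def k_def S_def)
qed

section \<open>Restriction of the prior to a Kullback-Leibler neighbourhood\<close>

text \<open>The chain rule for \<open>D n\<close> turns the left side into an expected
  \<open>sub_ln (D n \<omega>)\<close>. The variational bound under the prior compares it with
  \<open>sub_ln\<close> of the likelihood ratios over \<open>A\<close>, which the chain rule for a
  single density controls. The prior mass p is kept as a factor and divided out at the end.\<close>

lemma sum_KL_predictive_le:
  assumes A: "A \<in> sets prior" and pos: "0 < measure prior A"
    and KL: "\<And>f. f \<in> A \<Longrightarrow> KL_nn \<mu> fstar f \<le> e"
  shows "(\<Sum>i=1..n. \<integral>\<^sup>+ \<omega>. KL_nn \<mu> fstar (Q (i - 1) \<omega>) \<partial>P) \<le> of_nat n * e + ennreal (- ln (measure prior A))"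
proof -
  interpret PP: pair_sigma_finite P prior ..
  define p where "p = ennreal (measure prior A)"
  define L where "L = ennreal (- ln (measure prior A))"
  define X where "X = (\<Sum>i=1..n. \<integral>\<^sup>+ \<omega>. KL_nn \<mu> fstar (Q (i - 1) \<omega>) \<partial>P)"
  define d where "d = (\<integral>\<^sup>+ \<omega>. D n \<omega> \<partial>P)"
  define r where "r = (\<integral>\<^sup>+ \<omega>. (\<integral>\<^sup>+ f \<in> A. R n \<omega> f \<partial>prior) \<partial>P)"
  define g where "g = (\<integral>\<^sup>+ \<omega>. (\<integral>\<^sup>+ f \<in> A. sub_ln (R n \<omega> f) \<partial>prior) \<partial>P)"
  have p: "emeasure prior A = p" "p \<noteq> 0" "p \<noteq> \<top>"
    using pos by (auto simp: p_def prior.emeasure_eq_measure)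
  have [measurable]: "(\<lambda>x. R n (fst x) (snd x)) \<in> borel_measurable (P \<Otimes>\<^sub>M prior)"
    using measurable_R_pair by (simp add: split_beta')
  note A[measurable]
  have mr: "(\<lambda>(\<omega>, f). R n \<omega> f * indicator A f) \<in> borel_measurable (P \<Otimes>\<^sub>M prior)"
    and mg: "(\<lambda>(\<omega>, f). sub_ln (R n \<omega> f) * indicator A f) \<in> borel_measurable (P \<Otimes>\<^sub>M prior)"
    unfolding split_beta' by measurable
  note [measurable] = prior.borel_measurable_nn_integral[OF mr] prior.borel_measurable_nn_integral[OF mg]
  have "p * (X + d) + r = (\<integral>\<^sup>+ \<omega>. p * sub_ln (D n \<omega>) + (\<integral>\<^sup>+ f \<in> A. R n \<omega> f \<partial>prior) \<partial>P)"
    unfolding X_def d_def nn_integral_sub_ln_D r_def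
    by (subst nn_integral_add) (auto simp: nn_integral_cmult)
  also have "\<dots> \<le> (\<integral>\<^sup>+ \<omega>. p * D n \<omega> + (\<integral>\<^sup>+ f \<in> A. sub_ln (R n \<omega> f) \<partial>prior) + p * L \<partial>P)"
    unfolding p_def L_def
    by (intro nn_integral_mono prior.sub_ln_nn_integral_bound A pos measurable_R_prior)
  also have "\<dots> = p * d + g + p * L"
    unfolding d_def g_def by (simp add: nn_integral_add nn_integral_cmult P.emeasure_space_1)
  \<comment> \<open>Fubini fixes the density first, so that the chain rule for \<open>R n\<close>
    applies to each \<open>f\<close> in \<open>A\<close>.\<close>
  also have "g = (\<integral>\<^sup>+ f. \<integral>\<^sup>+ \<omega>. sub_ln (R n \<omega> f) * indicator A f \<partial>P \<partial>prior)"
    unfolding g_def by (rule PP.Fubini'[OF mg, symmetric])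
  also have "\<dots> \<le> (\<integral>\<^sup>+ f. of_nat n * e * indicator A f + (\<integral>\<^sup>+ \<omega>. R n \<omega> f * indicator A f \<partial>P) \<partial>prior)"
  proof (intro nn_integral_mono)
    fix f assume f: "f \<in> space prior"
    show "(\<integral>\<^sup>+ \<omega>. sub_ln (R n \<omega> f) * indicator A f \<partial>P)
        \<le> of_nat n * e * indicator A f + (\<integral>\<^sup>+ \<omega>. R n \<omega> f * indicator A f \<partial>P)"
      using nn_integral_sub_ln_R[OF f, of n] KL[of f]
      by (auto split: split_indicator intro!: add_right_mono mult_left_mono)
  qed
  also have "\<dots> = of_nat n * e * p + (\<integral>\<^sup>+ f. \<integral>\<^sup>+ \<omega>. R n \<omega> f * indicator A f \<partial>P \<partial>prior)"
  proof (subst nn_integral_add)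
    have "(\<lambda>(f, \<omega>). R n \<omega> f * indicator A f) \<in> borel_measurable (prior \<Otimes>\<^sub>M P)"
      using measurable_pair_swap[OF mr] by (simp add: split_beta')
    then show "(\<lambda>f. \<integral>\<^sup>+ \<omega>. R n \<omega> f * indicator A f \<partial>P) \<in> borel_measurable prior"
      by (rule P.borel_measurable_nn_integral)
  qed (simp_all add: nn_integral_cmult_indicator p)
  also have "(\<integral>\<^sup>+ f. \<integral>\<^sup>+ \<omega>. R n \<omega> f * indicator A f \<partial>P \<partial>prior) = r"
    unfolding r_def by (rule PP.Fubini'[OF mr])
  finally have "p * (X + d) + r \<le> p * d + (of_nat n * e * p + r) + p * L"
    by (simp add: add_mono)
  \<comment> \<open>The linear terms p d and r occur on both sides; they are finite since r \<le> d
    \<le> 1.\<close>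
  then have "p * X + (p * d + r) \<le> p * (of_nat n * e + L) + (p * d + r)"
    by (simp add: algebra_simps)
  moreover have "p * d + r < \<top>"
  proof -
    have "d \<le> 1" unfolding d_def by (rule nn_integral_D_le)
    moreover have "r \<le> d"
      unfolding r_def d_def by (intro nn_integral_mono) (auto split: split_indicator)
    ultimately show ?thesis
      using p(3) by (auto simp: ennreal_mult_eq_top_iff less_top[symmetric] top_unique)
  qed
  ultimately have "p * X \<le> p * (of_nat n * e + L)"
    by (rule ennreal_add_right_le_cancel)
  then show ?thesis
    using p by (simp add: ennreal_mult_le_mult_iff X_def L_def)
qed

text \<open>Convexity is applied for each fixed data sequence; the index i - 1 runs from the prior
  mean to the predictive density given n - 1 observations.\<close>

lemma KL_avg_predictive_le:
  assumes n: "1 \<le> n" and \<omega>: "\<omega> \<in> space P"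
  shows "KL_dens \<mu> fstar (avg_predictive prior fstar (\<lambda>j. Y j \<omega>) n)
      = enn2ereal (KL_nn \<mu> fstar (avg_predictive prior fstar (\<lambda>j. Y j \<omega>) n))"
    and "KL_nn \<mu> fstar (avg_predictive prior fstar (\<lambda>j. Y j \<omega>) n)
      \<le> (\<Sum>i=1..n. KL_nn \<mu> fstar (Q (i - 1) \<omega>)) / of_nat n"
proof -
  have Q: "Q (i - 1) \<omega> \<in> borel_measurable \<mu>" "(\<integral>\<^sup>+ x. Q (i - 1) \<omega> x \<partial>\<mu>) \<le> 1" for i
    using \<omega> by (auto intro: measurable_Q_dens nn_integral_Q_le)
  have I: "finite {1..n}" "{1..n} \<noteq> {}" using n by auto
  have avg: "avg_predictive prior fstar (\<lambda>j. Y j \<omega>) n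
      = (\<lambda>x. (\<Sum>i=1..n. Q (i - 1) \<omega> x) / of_nat (card {1..n}))"
    by (simp add: avg_predictive_def fun_eq_iff)
  note m = KL_nn_mean[OF fstar I, of "\<lambda>i. Q (i - 1) \<omega>", OF Q]
  show "KL_nn \<mu> fstar (avg_predictive prior fstar (\<lambda>j. Y j \<omega>) n)
      \<le> (\<Sum>i=1..n. KL_nn \<mu> fstar (Q (i - 1) \<omega>)) / of_nat n"
    unfolding avg using m(2) by simp
  show "KL_dens \<mu> fstar (avg_predictive prior fstar (\<lambda>j. Y j \<omega>) n)
      = enn2ereal (KL_nn \<mu> fstar (avg_predictive prior fstar (\<lambda>j. Y j \<omega>) n))"
    unfolding avg by (rule KL_dens_eq[OF fstar _ m(1)]) (intro borel_measurable_divide_ennreal borel_measurable_sum Q, simp)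
qed

end

section \<open>Risk bounds at a fixed sample size\<close>

theorem proposition1:
  fixes \<mu> :: "'y measure"
    and P :: "'w measure"
    and Y :: "nat \<Rightarrow> 'w \<Rightarrow> 'y"
    and fstar :: "'y \<Rightarrow> ennreal"
    and \<F> :: "('y \<Rightarrow> ennreal) set"
    and prior :: "('y \<Rightarrow> ennreal) measure"
    and C :: real
    and \<epsilon> :: "nat \<Rightarrow> real"
  assumes mu: "sigma_finite_measure \<mu>"
    and P: "prob_space P"
    and fstar: "prob_density \<mu> fstar"
    and Y_indep: "prob_space.indep_vars P (\<lambda>_. \<mu>) Y {1..}"
    and Y_distr: "\<And>i. i \<ge> 1 \<Longrightarrow> distributed P \<mu> (Y i) fstar"
    and F: "\<And>f. f \<in> \<F> \<Longrightarrow> prob_density \<mu> f"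
    and prior_prob: "prob_space prior" "space prior = \<F>"
    and eval_meas: "(\<lambda>(f, y). f y) \<in> borel_measurable (prior \<Otimes>\<^sub>M \<mu>)"
    and C: "C > 0"
    and eps_pos: "\<And>n. n \<ge> 1 \<Longrightarrow> \<epsilon> n > 0"
    and eps_0: "\<epsilon> \<longlonglongrightarrow> 0"
    and n_eps: "filterlim (\<lambda>n. real n * (\<epsilon> n)\<^sup>2) at_top sequentially"
    and prior_mass: "\<And>n. n \<ge> 1 \<Longrightarrow>
      measure prior {f \<in> \<F>. KL_dens \<mu> fstar f \<le> ereal ((\<epsilon> n)\<^sup>2)} \<ge> exp (- C * real n * (\<epsilon> n)\<^sup>2)"
  shows "\<forall>n \<ge> 1.
      ereal (1 / real n) *
        (\<Sum>i = 1..n. ext_integral P (\<lambda>\<omega>. KL_dens \<mu> fstar (predictive prior fstar (\<lambda>j. Y j \<omega>) (i - 1))))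
        \<le> ereal ((C + 1) * (\<epsilon> n)\<^sup>2)
      \<and> ext_integral P (\<lambda>\<omega>. KL_dens \<mu> fstar (avg_predictive prior fstar (\<lambda>j. Y j \<omega>) n))
        \<le> ereal ((C + 1) * (\<epsilon> n)\<^sup>2)"
proof (intro allI impI)
  fix n :: nat assume n: "1 \<le> n"
  interpret iid_bayes P prior \<mu> Y fstar
    by (intro iid_bayes.intro iid_bayes_axioms.intro P prior_prob(1) mu fstar Y_indep Y_distr eval_meas)
      (simp_all add: F prior_prob(2))
  define e where "e = (\<epsilon> n)\<^sup>2"
  define A where "A = {f \<in> \<F>. KL_dens \<mu> fstar f \<le> ereal e}"
  define X where "X = (\<Sum>i=1..n. \<integral>\<^sup>+ \<omega>. KL_nn \<mu> fstar (Q (i - 1) \<omega>) \<partial>P)"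
  have e: "0 \<le> e" by (simp add: e_def)
  have mass: "exp (- C * real n * e) \<le> measure prior A"
    using prior_mass[OF n] by (simp add: A_def e_def)
  then have pos: "0 < measure prior A"
    using exp_gt_zero less_le_trans by blast
  \<comment> \<open>A nonmeasurable set has \<open>measure\<close> 0, so positive mass already
    forces measurability.\<close>
  then have A: "A \<in> sets prior"
    using measure_notin_sets by fastforce
  \<comment> \<open>The prior mass condition supplies the C in C + 1; the radius \<open>e\<close> of
    the ball supplies the 1.\<close>
  have "- ln (measure prior A) \<le> C * real n * e"
    using ln_mono[OF mass] by simp
  have KL: "KL_nn \<mu> fstar f \<le> ennreal e" if "f \<in> A" for f
  proof -
    have "enn2ereal (KL_nn \<mu> fstar f) \<le> ereal e"
      using that F[of f] KL_dens_eq[OF fstar, of f] by (simp add: A_def prob_density_def)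
    then show ?thesis using e by (simp add: less_eq_ennreal.rep_eq)
  qed
  have "X \<le> of_nat n * ennreal e + ennreal (- ln (measure prior A))"
    unfolding X_def by (rule sum_KL_predictive_le[OF A pos KL])
  also have "\<dots> \<le> of_nat n * ennreal e + ennreal (C * real n * e)"
    by (intro add_left_mono ennreal_leI) fact
  also have "\<dots> = ennreal (real n * ((C + 1) * e))"
    using C e by (simp add: ennreal_of_nat_eq_real_of_nat algebra_simps flip: ennreal_mult ennreal_plus)
  finally have X: "X \<le> ennreal (real n * ((C + 1) * e))" .
  have "(\<Sum>i=1..n. ext_integral P (\<lambda>\<omega>. KL_dens \<mu> fstar (Q (i - 1) \<omega>))) = enn2ereal X"
    unfolding X_def
    by (subst sum_enn2ereal[symmetric], simp, intro sum.cong refl ext_integral_enn2ereal KL_dens_eq fstar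
        measurable_Q_dens nn_integral_Q_le)
  moreover have "enn2ereal X \<le> ereal (real n * ((C + 1) * e))"
    using X C e by (simp add: less_eq_ennreal.rep_eq)
  then have "ereal (1 / real n) * enn2ereal X \<le> ereal (1 / real n) * ereal (real n * ((C + 1) * e))"
    by (intro ereal_mult_left_mono) auto
  moreover have "ereal (1 / real n) * ereal (real n * ((C + 1) * e)) = ereal ((C + 1) * e)"
    using n by simp
  ultimately have 1: "ereal (1 / real n) * (\<Sum>i=1..n. ext_integral P (\<lambda>\<omega>. KL_dens \<mu> fstar (Q (i - 1) \<omega>)))
      \<le> ereal ((C + 1) * e)"
    by simp
  let ?avg = "\<lambda>\<omega>. avg_predictive prior fstar (\<lambda>j. Y j \<omega>) n"
  \<comment> \<open>Convexity reduces the risk of the averaged density to \<open>X\<close> / n, for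
    which the bound is already available.\<close>
  have "(\<integral>\<^sup>+ \<omega>. KL_nn \<mu> fstar (?avg \<omega>) \<partial>P) \<le> (\<integral>\<^sup>+ \<omega>. (\<Sum>i=1..n. KL_nn \<mu> fstar (Q (i - 1) \<omega>)) / of_nat n \<partial>P)"
    by (intro nn_integral_mono KL_avg_predictive_le n)
  also have "\<dots> = X / of_nat n"
    unfolding X_def by (simp add: nn_integral_divide nn_integral_sum)
  also have "\<dots> \<le> ennreal (real n * ((C + 1) * e)) / of_nat n"
    by (rule divide_right_mono_ennreal[OF X])
  also have "\<dots> = ennreal ((C + 1) * e)"
    using n C e by (simp add: ennreal_of_nat_eq_real_of_nat divide_ennreal)
  finally have "enn2ereal (\<integral>\<^sup>+ \<omega>. KL_nn \<mu> fstar (?avg \<omega>) \<partial>P) \<le> ereal ((C + 1) * e)"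
    using C e by (simp add: less_eq_ennreal.rep_eq)
  moreover have "ext_integral P (\<lambda>\<omega>. KL_dens \<mu> fstar (?avg \<omega>)) = enn2ereal (\<integral>\<^sup>+ \<omega>. KL_nn \<mu> fstar (?avg \<omega>) \<partial>P)"
    by (intro ext_integral_enn2ereal KL_avg_predictive_le n)
  ultimately show "ereal (1 / real n) *
        (\<Sum>i = 1..n. ext_integral P (\<lambda>\<omega>. KL_dens \<mu> fstar (predictive prior fstar (\<lambda>j. Y j \<omega>) (i - 1))))
        \<le> ereal ((C + 1) * (\<epsilon> n)\<^sup>2)
      \<and> ext_integral P (\<lambda>\<omega>. KL_dens \<mu> fstar (avg_predictive prior fstar (\<lambda>j. Y j \<omega>) n))
        \<le> ereal ((C + 1) * (\<epsilon> n)\<^sup>2)"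
    using 1 by (simp add: e_def)
qed

end
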